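(* Let $q\ge2$ be an integer and let $R(z,u)$ be the unique formal power series (in $z$, with coefficients polynomials in $u$) such that $$R=z+u\sum_{i\ge1}\frac{((2q-1)i)!}{i!\,((q-1)i)!\,((q-1)i+1)!}R^{(q-1)i+1}.$$ Then for every $n\in\{1,\dots,q\}$, the series $(R^n-z^n)/u$ is $(u+1)$-positive.
   Context: A formal power series $A$ in variables $z_1,\dots,z_m$ with coefficients in $\mathbb R[u]$ is called $(u+1)$-positive if, after substituting $u=\mu-1$, the series $A(\mu-1,z_1,\dots,z_m)$ has nonnegative coefficients as a series in $\mu,z_1,\dots,z_m$ (i.e. its coefficients are nonnegative in the basis given by monomials in $1+u,z_1,\dots,z_m$). *)

theory Defs
  imports "HOL-Computational_Algebra.Polynomial" "HOL-Computational_Algebra.Formal_Power_Series"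
begin

text \<open>Series in z with coefficients in R[u]: type real poly fps. The variable u is [:0,1:].\<close>

definition cR :: "nat \<Rightarrow> nat \<Rightarrow> real" where
  "cR q i = fact ((2*q-1)*i) / (fact i * fact ((q-1)*i) * fact ((q-1)*i+1))"

text \<open>The formal infinite sum over i >= 1 of cR q i * R^((q-1)i+1), for R with zero
  constant term (q >= 2). Its n-th coefficient only receives contributions from i <= n,
  since R^((q-1)i+1) has order at least (q-1)i+1 > i.\<close>
definition Rsum :: "nat \<Rightarrow> real poly fps \<Rightarrow> real poly fps" where
  "Rsum q R = Abs_fps (\<lambda>n. \<Sum>i=1..n. smult (cR q i) (fps_nth (R ^ ((q-1)*i+1)) n))"

definition u_plus_one_positive :: "real poly fps \<Rightarrow> bool" where
  "u_plus_one_positive A \<longleftrightarrow>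
     (\<forall>k j. coeff (pcompose (fps_nth A k) [:-1, 1:]) j \<ge> 0)"

end

theory Submission
  imports Defs "HOL-Library.Poly_Mapping"
begin

text \<open>
  Write R = z r and p = 2q - 1, and let y be an auxiliary variable. The summand c_i of the equation is
  t_i ((p - 1) i + 1 choose (q - 1) i + 1), where t_i is the number of p-ary trees with i nodes, so
  c_i r^((q - 1) i + 1) is the coefficient of y in t_i (r y + 1/y)^((p - 1) i + 1). Hence the series B
  of p-ary trees with leaves r y + 1/y, counted by z^(q - 1) per node, satisfies
  B = r y + 1/y + z^(q - 1) B^p and [y] B = r + \<Phi>, where r = 1 + u \<Phi>; that is,
  [y] B = 1 + (1 + u) \<Phi>.

  Only odd powers of y occur in B, and exchanging r y with 1/y gives [y^k] B = r^k [y^(-k)] B. By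
  induction on the degree in z, r^m [y^(-k)] B is (u+1)-positive for odd k > 0 and m \<le> k: expand B^p and
  distribute the powers of r over the factors of negative y-degree. In a product of p odd powers of y
  with total degree -1 these factors absorb at least q powers of r. Since \<Phi> = z^(q - 1) r [y^(-1)] B^p,
  all \<Phi> R^j with j < q are (u+1)-positive, and
  (R^n - z^n) / u = z \<Phi> (sum over j < n of z^(n - 1 - j) R^j).
\<close>

section \<open>Fuss-Catalan numbers\<close>

text \<open>The numbers a / (a + p n) (a + p n choose n), the coefficients of the a-th power of the
  generating function of p-ary trees.\<close>

fun fuss :: "nat \<Rightarrow> nat \<Rightarrow> nat \<Rightarrow> nat" where
  "fuss p 0 a = 1"
| "fuss p (Suc n) 0 = 0"
| "fuss p (Suc n) (Suc a) = fuss p (Suc n) a + fuss p n (a + p)"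

text \<open>Coefficient form of B^a B^b = B^(a + b) for the p-ary tree series B. Peeling one step of
  the recursion, which encodes B^(a + 1) = B^a + z B^(a + p), leaves the same claim for smaller a
  and, with a + p in place of a, for smaller n.\<close>

lemma fuss_convolution:
  "(\<Sum>i\<le>n. fuss p i a * fuss p (n - i) b) = fuss p n (a + b)"
proof (induction n arbitrary: a)
  case 0
  show ?case by simp
next
  case (Suc n)
  show ?case
  proof (induction a)
    case 0
    show ?case by (simp only: sum.atMost_Suc_shift) simp
  next
    case (Suc a)
    have "(\<Sum>i\<le>Suc n. fuss p i (Suc a) * fuss p (Suc n - i) b)
        = (\<Sum>i\<le>Suc n. fuss p i a * fuss p (Suc n - i) b)
          + (\<Sum>i\<le>n. fuss p i (a + p) * fuss p (n - i) b)"
      by (simp only: sum.atMost_Suc_shift) (simp add: algebra_simps sum.distrib)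
    then show ?case
      using Suc.IH \<open>\<And>a. (\<Sum>i\<le>n. fuss p i a * fuss p (n - i) b) = fuss p n (a + b)\<close>[of "a + p"]
      by (simp add: ac_simps)
  qed
qed

text \<open>Once the factorials are cleared, the recursion in a amounts to the polynomial identity
  \<open>num\<close> below.\<close>

lemma fuss_closed_form:
  assumes "0 < p" "0 < a"
  shows "real (fuss p n a) * (fact n * fact (a + p * n - n)) = real a * fact (a + p * n - 1)"
  using assms(2)
proof (induction n arbitrary: a)
  case 0
  then show ?case by (cases a) simp_all
next
  case (Suc n)
  note outer_IH = Suc.IH
  \<comment> \<open>For a positive number of nodes both sides vanish at a = 0, so the inner
    induction on a can start there.\<close>
  have "real (fuss p (Suc n) a) * (fact (Suc n) * fact (a + p * Suc n - Suc n))
      = real a * fact (a + p * Suc n - 1)" for a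
  proof (induction a)
    case 0
    show ?case by simp
  next
    case (Suc a)
    define M where "M = a + (p - 1) * Suc n"
    have M: "a + p * Suc n - Suc n = M" "Suc a + p * Suc n - Suc n = Suc M"
        "a + p + p * n - n = Suc M" "a + p * Suc n = M + Suc n"
        "a + p * Suc n - 1 = M + n" "Suc a + p * Suc n - 1 = Suc (M + n)"
        "a + p + p * n - 1 = M + n"
      using assms(1) by (cases p; simp add: M_def algebra_simps)+
    define X where "X = real (fuss p (Suc n) a)"
    define Y where "Y = real (fuss p n (a + p))"
    define F where "F = (fact (M + n) :: real)"
    have X: "X * (fact (Suc n) * fact M) = real a * F"
      using Suc.IH unfolding X_def F_def M by simp
    have Y: "Y * (fact n * fact (Suc M)) = real (a + p) * F"
      using outer_IH[of "a + p"] assms(1) unfolding Y_def F_def M by simp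
    have "real a + real p * (real n + 1) = real M + (real n + 1)"
      using arg_cong[OF M(4), of real] by (simp add: algebra_simps)
    then have num: "(real M + 1) * real a + (real n + 1) * (real a + real p)
        = (real a + 1) * (real M + real n + 1)"
      by (simp add: algebra_simps) 
    have "(X + Y) * (fact (Suc n) * fact (Suc M))
        = (real M + 1) * (X * (fact (Suc n) * fact M)) + (real n + 1) * (Y * (fact n * fact (Suc M)))"
      by (simp add: algebra_simps)
    also have "\<dots> = ((real M + 1) * real a + (real n + 1) * (real a + real p)) * F"
      unfolding X Y by (simp add: algebra_simps)
    also have "\<dots> = real (Suc a) * fact (Suc (M + n))"
      unfolding num by (simp add: F_def algebra_simps)
    finally show ?case
      unfolding M X_def Y_def by simp
  qed
  then show ?case by blast
qed

section \<open>Infinite sums of power series\<close>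

text \<open>The infinite sum of the f i; meaningful only under \<open>summand\<close>.\<close>

definition fsum :: "(nat \<Rightarrow> 'a::comm_ring_1 fps) \<Rightarrow> 'a fps" where
  "fsum f = Abs_fps (\<lambda>n. \<Sum>i\<le>n. fps_nth (f i) n)"

definition summand :: "(nat \<Rightarrow> 'a::comm_ring_1 fps) \<Rightarrow> bool" where
  "summand f \<longleftrightarrow> (\<forall>i n. n < i \<longrightarrow> fps_nth (f i) n = 0)"

lemma summandD: "summand f \<Longrightarrow> n < i \<Longrightarrow> fps_nth (f i) n = 0"
  by (auto simp: summand_def)

lemma fsum_nth: "fps_nth (fsum f) n = (\<Sum>i\<le>n. fps_nth (f i) n)"
  by (simp add: fsum_def)

text \<open>Terms beyond n contribute nothing in degree n, so all coefficients up to N can share one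
  summation range; products and interchanges of sums rely on this.\<close>

lemma fsum_nth_ge:
  assumes "summand f" "n \<le> N"
  shows "fps_nth (fsum f) n = (\<Sum>i\<le>N. fps_nth (f i) n)"
  unfolding fsum_nth
  by (rule sum.mono_neutral_left) (use assms in \<open>auto simp: summandD\<close>)

text \<open>The order of \<open>f i * g j\<close> is at least i + j, so in degree n the square of
  index pairs shrinks to the triangle i + j \<le> n, which is summed along its diagonals.\<close>

lemma fsum_mult:
  assumes f: "summand f" and g: "summand g"
  shows "fsum f * fsum g = fsum (\<lambda>k. \<Sum>i\<le>k. f i * g (k - i))"
proof (rule fps_ext)
  fix n
  have high: "fps_nth (f i * g j) n = 0" if "n < i + j" for i j
    unfolding fps_mult_nth
  proof (rule sum.neutral, rule ballI)
    fix a assume "a \<in> {0..n}"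
    with that have "a < i \<or> n - a < j" by auto
    then show "fps_nth (f i) a * fps_nth (g j) (n - a) = 0"
      using f g by (auto simp: summandD)
  qed
  have "fps_nth (fsum f * fsum g) n
      = (\<Sum>a=0..n. (\<Sum>i\<le>n. fps_nth (f i) a) * (\<Sum>j\<le>n. fps_nth (g j) (n - a)))"
    unfolding fps_mult_nth
    by (intro sum.cong refl) (simp add: fsum_nth_ge[OF f, of _ n] fsum_nth_ge[OF g, of _ n])
  also have "\<dots> = fps_nth ((\<Sum>i\<le>n. f i) * (\<Sum>j\<le>n. g j)) n"
    by (simp add: fps_mult_nth fps_sum_nth)
  also have "\<dots> = (\<Sum>(i, j)\<in>{..n} \<times> {..n}. fps_nth (f i * g j) n)"
    by (simp add: sum_product fps_sum_nth sum.cartesian_product case_prod_beta)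
  also have "\<dots> = (\<Sum>(i, j)\<in>{(i, j). i + j \<le> n}. fps_nth (f i * g j) n)"
    using high by (intro sum.mono_neutral_right) (auto, meson not_le)
  also have "\<dots> = (\<Sum>k\<le>n. \<Sum>i\<le>k. fps_nth (f i * g (k - i)) n)"
    by (rule sum.triangle_reindex_eq)
  also have "\<dots> = fps_nth (fsum (\<lambda>k. \<Sum>i\<le>k. f i * g (k - i))) n"
    by (simp add: fsum_nth fps_sum_nth)
  finally show "fps_nth (fsum f * fsum g) n = fps_nth (fsum (\<lambda>k. \<Sum>i\<le>k. f i * g (k - i))) n" .
qed

lemma fsum_mult_left:
  assumes "summand f"
  shows "c * fsum f = fsum (\<lambda>i. c * f i)"
proof (rule fps_ext)
  fix n
  have "fps_nth (c * fsum f) n = (\<Sum>a=0..n. fps_nth c a * (\<Sum>i\<le>n. fps_nth (f i) (n - a)))"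
    unfolding fps_mult_nth
    by (intro sum.cong refl) (simp add: fsum_nth_ge[OF assms, of _ n])
  also have "\<dots> = (\<Sum>i\<le>n. fps_nth (c * f i) n)"
    by (simp add: fps_mult_nth sum_distrib_left) (rule sum.swap)
  finally show "fps_nth (c * fsum f) n = fps_nth (fsum (\<lambda>i. c * f i)) n"
    by (simp add: fsum_nth)
qed

lemma fsum_Suc:
  assumes "summand f"
  shows "fsum f = f 0 + fsum (\<lambda>i. f (Suc i))"
proof (rule fps_ext)
  fix n
  \<comment> \<open>One term more than degree n requires: after i = 0 is split off, the shifted sum
    ends at n, as in \<open>fsum\<close>.\<close>
  have "fps_nth (fsum f) n = (\<Sum>i\<le>Suc n. fps_nth (f i) n)"
    by (rule fsum_nth_ge[OF assms]) simp
  also have "\<dots> = fps_nth (f 0 + fsum (\<lambda>i. f (Suc i))) n"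
    by (simp add: sum.atMost_Suc_shift fsum_nth del: sum.atMost_Suc)
  finally show "fps_nth (fsum f) n = fps_nth (f 0 + fsum (\<lambda>i. f (Suc i))) n" .
qed

lemma nth_mult_power_eq_0:
  fixes v :: "'a::comm_ring_1 fps"
  assumes "fps_nth v 0 = 0" "n < i"
  shows "fps_nth (a * v ^ i) n = 0"
proof -
  have "fps_nth (v ^ i) m = 0" if "m < i" for m
    using that assms(1) by (simp add: startsby_zero_power_prefix)
  with assms(2) show ?thesis
    unfolding fps_mult_nth by (intro sum.neutral) auto
qed

lemma summandI:
  assumes "fps_nth v 0 = 0" "\<And>i. f i = g i * v ^ i"
  shows "summand f"
  using assms nth_mult_power_eq_0 unfolding summand_def by metis

section \<open>Powers of the tree series\<close>

text \<open>The a-th power of the solution B of B = x + v B^p. A forest of a p-ary trees with i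
  nodes has (p - 1) i + a leaves; v marks nodes and x marks leaves.\<close>

definition fuss_series :: "nat \<Rightarrow> 'a::comm_ring_1 fps \<Rightarrow> 'a fps \<Rightarrow> nat \<Rightarrow> 'a fps" where
  "fuss_series p v x a = fsum (\<lambda>i. of_nat (fuss p i a) * x ^ ((p - 1) * i + a) * v ^ i)"

context
  fixes p :: nat and v x :: "'a::comm_ring_1 fps"
  assumes p: "0 < p" and v: "fps_nth v 0 = 0"
begin

lemma fuss_series_add:
  "fuss_series p v x (a + b) = fuss_series p v x a * fuss_series p v x b"
proof -
  have *: "(\<Sum>i\<le>k. (of_nat (fuss p i a) * x ^ ((p - 1) * i + a) * v ^ i)
        * (of_nat (fuss p (k - i) b) * x ^ ((p - 1) * (k - i) + b) * v ^ (k - i)))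
      = of_nat (fuss p k (a + b)) * x ^ ((p - 1) * k + (a + b)) * v ^ k" for k
  proof -
    have "(\<Sum>i\<le>k. (of_nat (fuss p i a) * x ^ ((p - 1) * i + a) * v ^ i)
        * (of_nat (fuss p (k - i) b) * x ^ ((p - 1) * (k - i) + b) * v ^ (k - i)))
      = (\<Sum>i\<le>k. of_nat (fuss p i a * fuss p (k - i) b) * (x ^ ((p - 1) * k + (a + b)) * v ^ k))"
    proof (rule sum.cong[OF refl])
      fix i assume "i \<in> {..k}"
      then have "(p - 1) * k = (p - 1) * i + (p - 1) * (k - i)" "v ^ k = v ^ i * v ^ (k - i)"
        by (simp_all only: atMost_iff flip: distrib_left power_add) simp_all
      then show "(of_nat (fuss p i a) * x ^ ((p - 1) * i + a) * v ^ i)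
        * (of_nat (fuss p (k - i) b) * x ^ ((p - 1) * (k - i) + b) * v ^ (k - i))
        = of_nat (fuss p i a * fuss p (k - i) b) * (x ^ ((p - 1) * k + (a + b)) * v ^ k)"
        by (simp only: power_add of_nat_mult) (simp add: ac_simps)
    qed
    also have "\<dots> = of_nat (\<Sum>i\<le>k. fuss p i a * fuss p (k - i) b) * (x ^ ((p - 1) * k + (a + b)) * v ^ k)"
      by (simp only: of_nat_sum sum_distrib_right)
    finally show ?thesis
      by (simp add: fuss_convolution mult.assoc)
  qed
  show ?thesis
    unfolding fuss_series_def
    by (simp only: fsum_mult[OF summandI[OF v refl] summandI[OF v refl]] * )
qed

lemma fuss_series_0: "fuss_series p v x 0 = 1"
proof (rule fps_ext)
  fix n
  have "of_nat (fuss p i 0) * x ^ ((p - 1) * i + 0) * v ^ i = (if i = 0 then 1 else 0)" for i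
    by (cases i) simp_all
  then show "fps_nth (fuss_series p v x 0) n = fps_nth 1 n"
    by (simp only: fuss_series_def fsum_nth) (auto intro!: sum.neutral)
qed

lemma fuss_series_power: "fuss_series p v x a = fuss_series p v x 1 ^ a"
proof (induction a)
  case 0
  show ?case by (simp only: fuss_series_0 power_0)
next
  case (Suc a)
  then show ?case
    using fuss_series_add[of 1 a] by (simp only: plus_1_eq_Suc power_Suc)
qed

text \<open>The term i = 0 is the single leaf; a tree with i + 1 nodes is a root with p subtrees
  having i nodes in total.\<close>

lemma fuss_series_1: "fuss_series p v x 1 = x + v * fuss_series p v x p"
proof -
  have "fuss p (Suc i) 1 = fuss p i p" for i
    by simp
  moreover have "(p - 1) * Suc i + 1 = (p - 1) * i + p" for i
    using p by (cases p) auto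
  ultimately show ?thesis
    unfolding fuss_series_def
    by (subst fsum_Suc[OF summandI[OF v refl]], subst fsum_mult_left[OF summandI[OF v refl]])
       (simp add: ac_simps)
qed

end


section \<open>Series with Laurent polynomials in y as coefficients\<close>

text \<open>The type \<open>int \<Rightarrow>\<^sub>0 'a\<close> with its convolution product models
  Laurent polynomials in y. Each power of z carries only finitely many powers of y, so products make
  sense with exponents of both signs.\<close>

definition scalar :: "'a::comm_ring_1 fps \<Rightarrow> (int \<Rightarrow>\<^sub>0 'a) fps" where
  "scalar F = Abs_fps (\<lambda>n. Poly_Mapping.single 0 (fps_nth F n))"

definition ycoeff :: "int \<Rightarrow> (int \<Rightarrow>\<^sub>0 'a::comm_ring_1) fps \<Rightarrow> 'a fps" where
  "ycoeff k F = Abs_fps (\<lambda>n. Poly_Mapping.lookup (fps_nth F n) k)"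

definition ypow :: "int \<Rightarrow> (int \<Rightarrow>\<^sub>0 'a::comm_ring_1) fps" where
  "ypow k = fps_const (Poly_Mapping.single k 1)"

lemma single_sum: "Poly_Mapping.single k (sum f A) = (\<Sum>x\<in>A. Poly_Mapping.single k (f x))"
  by (induction A rule: infinite_finite_induct) (simp_all add: single_add)

lemma scalar_mult: "scalar (F * G) = scalar F * scalar G"
  by (rule fps_ext) (simp add: scalar_def fps_mult_nth single_sum mult_single)

lemma scalar_1: "scalar 1 = 1"
  by (rule fps_ext) (simp add: scalar_def)

lemma scalar_power: "scalar (F ^ n) = scalar F ^ n"
  by (induction n) (simp_all add: scalar_mult scalar_1)

lemma ypow_power: "ypow k ^ n = ypow (int n * k)"
  by (induction n) (simp_all add: ypow_def mult_single algebra_simps)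

lemma ypow_mult: "ypow k * ypow l = ypow (k + l)"
  by (simp add: ypow_def mult_single)

lemma ycoeff_add: "ycoeff k (F + G) = ycoeff k F + ycoeff k G"
  by (rule fps_ext) (simp add: ycoeff_def lookup_add)

lemma ycoeff_0: "ycoeff k 0 = 0"
  by (rule fps_ext) (simp add: ycoeff_def)

lemma ycoeff_sum: "ycoeff k (sum f A) = (\<Sum>x\<in>A. ycoeff k (f x))"
  by (induction A rule: infinite_finite_induct) (simp_all add: ycoeff_add ycoeff_0)

lemma ycoeff_fsum: "ycoeff k (fsum f) = fsum (\<lambda>i. ycoeff k (f i))"
  by (rule fps_ext) (simp add: ycoeff_def fsum_def lookup_sum)

lemma lookup_single_0_mult:
  fixes f :: "int \<Rightarrow>\<^sub>0 'a::comm_ring_1"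
  shows "Poly_Mapping.lookup (Poly_Mapping.single 0 c * f) k = c * Poly_Mapping.lookup f k"
  by (simp flip: mult_map_scale_conv_mult add: map.rep_eq when_def)

lemma ycoeff_scalar_mult: "ycoeff k (scalar c * F) = c * ycoeff k F"
  by (rule fps_ext) (simp add: ycoeff_def scalar_def fps_mult_nth lookup_sum lookup_single_0_mult)

lemma ycoeff_ypow: "ycoeff k (ypow l) = (if k = l then 1 else 0)"
  by (rule fps_ext) (auto simp: ycoeff_def ypow_def lookup_single when_def)

lemma ycoeff_1: "ycoeff k 1 = (if k = 0 then 1 else 0)"
  using ycoeff_ypow[of k 0] by (simp add: ypow_def)

lemma lookup_mult_sum:
  fixes f g :: "int \<Rightarrow>\<^sub>0 'a::comm_ring_1"
  assumes "finite L" "Poly_Mapping.keys f \<subseteq> L"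
  shows "Poly_Mapping.lookup (f * g) k = (\<Sum>l\<in>L. Poly_Mapping.lookup f l * Poly_Mapping.lookup g (k - l))"
proof -
  have "(\<Sum>q. Poly_Mapping.lookup g q when k = l + q) = Poly_Mapping.lookup g (k - l)" for l
  proof -
    have "(\<lambda>q. Poly_Mapping.lookup g q when k = l + q) = (\<lambda>q. Poly_Mapping.lookup g q when q = k - l)"
      by (auto simp: when_def)
    then show ?thesis by (simp only: Sum_any_when_equal)
  qed
  then have "Poly_Mapping.lookup (f * g) k = (\<Sum>l. Poly_Mapping.lookup f l * Poly_Mapping.lookup g (k - l))"
    by (simp add: lookup_mult)
  also have "\<dots> = (\<Sum>l\<in>L. Poly_Mapping.lookup f l * Poly_Mapping.lookup g (k - l))"
    by (rule Sum_any.expand_superset) (use assms in \<open>auto simp: in_keys_iff dest!: mult_not_zero\<close>)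
  finally show ?thesis .
qed

text \<open>A series F may involve infinitely many powers of y, so a finite index set exists only up
  to a degree bound N. The factor c is carried along because it is later split between the two
  factors.\<close>

lemma ycoeff_mult_nth:
  fixes F G :: "(int \<Rightarrow>\<^sub>0 'a::comm_ring_1) fps"
  obtains L where "finite L"
    "\<And>c n k. n \<le> N \<Longrightarrow> fps_nth (c * ycoeff k (F * G)) n
        = (\<Sum>l\<in>L. fps_nth (c * (ycoeff l F * ycoeff (k - l) G)) n)"
proof
  define L where "L = (\<Union>i\<le>N. Poly_Mapping.keys (fps_nth F i))"
  show "finite L"
    by (simp add: L_def)
  have eq: "fps_nth (ycoeff k (F * G)) n = fps_nth (\<Sum>l\<in>L. ycoeff l F * ycoeff (k - l) G) n"
    if "n \<le> N" for n k
  proof -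
    have "fps_nth (ycoeff k (F * G)) n
        = (\<Sum>i=0..n. Poly_Mapping.lookup (fps_nth F i * fps_nth G (n - i)) k)"
      by (simp add: ycoeff_def fps_mult_nth lookup_sum)
    also have "\<dots> = (\<Sum>i=0..n. \<Sum>l\<in>L. Poly_Mapping.lookup (fps_nth F i) l
        * Poly_Mapping.lookup (fps_nth G (n - i)) (k - l))"
      by (intro sum.cong refl lookup_mult_sum \<open>finite L\<close>) (use that in \<open>force simp: L_def\<close>)
    also have "\<dots> = (\<Sum>l\<in>L. \<Sum>i=0..n. Poly_Mapping.lookup (fps_nth F i) l
        * Poly_Mapping.lookup (fps_nth G (n - i)) (k - l))"
      by (rule sum.swap)
    finally show ?thesis
      by (simp add: ycoeff_def fps_mult_nth fps_sum_nth)
  qed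
  show "fps_nth (c * ycoeff k (F * G)) n
        = (\<Sum>l\<in>L. fps_nth (c * (ycoeff l F * ycoeff (k - l) G)) n)" if "n \<le> N" for c n k
  proof -
    have "fps_nth (c * ycoeff k (F * G)) n = fps_nth (c * (\<Sum>l\<in>L. ycoeff l F * ycoeff (k - l) G)) n"
      unfolding fps_mult_nth[of c] by (intro sum.cong refl) (use that in \<open>simp add: eq\<close>)
    then show ?thesis
      by (simp add: sum_distrib_left fps_sum_nth)
  qed
qed

lemma ycoeff_binomial:
  "ycoeff k ((scalar r * ypow 1 + ypow (-1)) ^ N)
     = (\<Sum>j\<le>N. if k = 2 * int j - int N then of_nat (N choose j) * r ^ j else 0)"
proof -
  have "(scalar r * ypow 1 + ypow (-1)) ^ N
      = (\<Sum>j\<le>N. scalar (of_nat (N choose j) * r ^ j) * ypow (2 * int j - int N))"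
    unfolding binomial_ring
  proof (rule sum.cong[OF refl])
    fix j assume "j \<in> {..N}"
    have "scalar (of_nat m :: 'a fps) = of_nat m" for m
      by (rule fps_ext) (simp add: scalar_def flip: fps_of_nat)
    then show "of_nat (N choose j) * (scalar r * ypow 1) ^ j * ypow (-1) ^ (N - j)
       = scalar (of_nat (N choose j) * r ^ j) * ypow (2 * int j - int N)"
      using \<open>j \<in> {..N}\<close>
      by (simp add: scalar_mult scalar_power power_mult_distrib ypow_power mult.assoc ypow_mult of_nat_diff)
  qed
  then show ?thesis
    by (simp add: ycoeff_sum ycoeff_scalar_mult ycoeff_ypow if_distrib cong: if_cong)
qed


text \<open>Here j may exceed N; the binomial coefficient is then 0.\<close>

lemma ycoeff_binomial_eq:
  assumes "k + int N = 2 * int j" 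
  shows "ycoeff k ((scalar r * ypow 1 + ypow (-1)) ^ N) = of_nat (N choose j) * r ^ j"
proof -
  have "ycoeff k ((scalar r * ypow 1 + ypow (-1)) ^ N)
      = (\<Sum>i\<le>N. if i = j then of_nat (N choose j) * r ^ j else 0)"
    unfolding ycoeff_binomial by (rule sum.cong) (use assms in auto)
  then show ?thesis
    by (simp add: binomial_eq_0)
qed

lemma ycoeff_binomial_eq_0:
  assumes "odd (k + int N) \<or> int N < \<bar>k\<bar>"
  shows "ycoeff k ((scalar r * ypow 1 + ypow (-1)) ^ N) = 0"
  unfolding ycoeff_binomial by (intro sum.neutral) (use assms in auto)

text \<open>If y^k arises from j factors r y, then y^(-k) arises from j - k = N - j of them; the
  binomial coefficients agree and r^k remains.\<close>

lemma ycoeff_binomial_symmetric: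
  "ycoeff (int k) ((scalar r * ypow 1 + ypow (-1)) ^ N)
     = r ^ k * ycoeff (- int k) ((scalar r * ypow 1 + ypow (-1)) ^ N)"
proof (cases "even (N + k) \<and> k \<le> N")
  case True
  then obtain j where j: "N + k = 2 * j" by blast
  with True have "N - j = j - k" "j \<le> N" "k \<le> j" by auto
  with j have e: "int k + int N = 2 * int j" "- int k + int N = 2 * int (j - k)"
      and "N choose (j - k) = N choose j" "r ^ j = r ^ k * r ^ (j - k)"
    by (auto simp: binomial_symmetric[of j N] simp flip: power_add)
  then show ?thesis
    by (simp add: ycoeff_binomial_eq[OF e(1)] ycoeff_binomial_eq[OF e(2)])
next
  case False
  then have "odd (int k + int N) \<or> int N < \<bar>int k\<bar>" "odd (- int k + int N) \<or> int N < \<bar>- int k\<bar>"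
    by (auto simp flip: of_nat_add)
  then show ?thesis
    by (simp add: ycoeff_binomial_eq_0)
qed

section \<open>Positivity in u + 1\<close>

definition upos :: "real poly \<Rightarrow> bool" where
  "upos a \<longleftrightarrow> (\<forall>j. 0 \<le> coeff (pcompose a [:-1, 1:]) j)"

lemma upos_0: "upos 0" and upos_1: "upos 1" and upos_u_plus_1: "upos [:1, 1:]"
  by (auto simp: upos_def pcompose_pCons pcompose_1 coeff_pCons split: nat.splits)

lemma upos_add: "upos a \<Longrightarrow> upos b \<Longrightarrow> upos (a + b)"
  by (simp add: upos_def pcompose_add)

lemma upos_mult: "upos a \<Longrightarrow> upos b \<Longrightarrow> upos (a * b)"
  by (auto simp: upos_def pcompose_mult coeff_mult intro!: sum_nonneg)

lemma upos_sum: "(\<And>x. x \<in> A \<Longrightarrow> upos (f x)) \<Longrightarrow> upos (sum f A)"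
  by (induction A rule: infinite_finite_induct) (auto intro: upos_0 upos_add)

text \<open>The truncation at N permits induction on the degree in z.\<close>

definition pos_below :: "nat \<Rightarrow> real poly fps \<Rightarrow> bool" where
  "pos_below N A \<longleftrightarrow> (\<forall>n<N. upos (fps_nth A n))"

lemma pos_below_0: "pos_below N 0" and pos_below_1: "pos_below N 1"
  by (auto simp: pos_below_def upos_0 upos_1)

lemma pos_below_const: "upos a \<Longrightarrow> pos_below N (fps_const a)"
  by (auto simp: pos_below_def upos_0)

lemma pos_below_add: "pos_below N A \<Longrightarrow> pos_below N B \<Longrightarrow> pos_below N (A + B)"
  by (auto simp: pos_below_def upos_add)

lemma pos_below_mult: "pos_below N A \<Longrightarrow> pos_below N B \<Longrightarrow> pos_below N (A * B)"
  by (auto simp: pos_below_def fps_mult_nth intro!: upos_sum upos_mult)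

lemma pos_below_sum: "(\<And>x. x \<in> I \<Longrightarrow> pos_below N (f x)) \<Longrightarrow> pos_below N (sum f I)"
  by (auto simp: pos_below_def fps_sum_nth intro!: upos_sum)

lemma pos_below_X_power: "pos_below N (fps_X ^ d)"
  by (auto simp: pos_below_def fps_X_power_nth upos_0 upos_1)

lemma pos_below_Suc_X_power_mult:
  assumes "pos_below N A" "0 < d"
  shows "pos_below (Suc N) (fps_X ^ d * A)"
  using assms by (auto simp: pos_below_def fps_X_power_mult_nth upos_0)

text \<open>If a odd exponents of y have sum -k, then their negative parts add up to at least
  max k ((a + k) / 2): this is the power of r that can be distributed over the factors.\<close>

lemma pos_below_ycoeff_power:
  assumes base: "\<And>l m. odd l \<Longrightarrow> int m \<le> max l 0 \<Longrightarrow> pos_below N (r ^ m * ycoeff (- l) F)"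
    and parity: "\<And>l. even l \<Longrightarrow> ycoeff l F = 0"
    and "even (k + int a)" "2 * int m \<le> max (max (2 * k) (k + int a)) 0"
  shows "pos_below N (r ^ m * ycoeff (- k) (F ^ a))"
  using assms(3,4)
proof (induction a arbitrary: k m)
  case 0
  then show ?case
    by (auto simp: ycoeff_1 pos_below_0 pos_below_1)
next
  case (Suc a)
  obtain L where L: "finite L" "\<And>c n k. n \<le> N \<Longrightarrow> fps_nth (c * ycoeff k (F * F ^ a)) n
        = (\<Sum>l\<in>L. fps_nth (c * (ycoeff l F * ycoeff (k - l) (F ^ a))) n)"
    using ycoeff_mult_nth by blast
  have summand_pos: "pos_below N (r ^ m * (ycoeff l F * ycoeff (- k - l) (F ^ a)))" for l
  proof (cases "even l")
    case True
    then show ?thesis by (simp add: parity pos_below_0)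
  next
    case False
    \<comment> \<open>A factor y^l with l < 0 takes up to -l powers of r, the limit in
      \<open>base\<close>; the other a factors, of total exponent -(k + l), receive the remaining
      \<open>m2\<close>.\<close>
    define m1 where "m1 = min m (nat (max (- l) 0))"
    define m2 where "m2 = m - m1"
    have "int m1 \<le> max (- l) 0" "m = m1 + m2"
      by (auto simp: m1_def m2_def)
    moreover have "2 * int m2 \<le> max (max (2 * (k + l)) (k + l + int a)) 0"
    proof -
      \<comment> \<open>Passing from a + 1 to a factors lowers the bound, and a nonzero l makes up
        for it: l \<ge> 1 raises k + l, while for l \<le> -1 the powers \<open>m1\<close> are taken
        off. The estimate would break at l = 0, which parity excludes.\<close>
      from False have "l \<ge> 1 \<or> l \<le> -1" by (cases "l = 0") auto
      then show ?thesis
        using Suc.prems(2) unfolding m1_def m2_def by auto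
    qed
    moreover have "even (k + l + int a)"
      using Suc.prems(1) False by simp
    ultimately have "pos_below N ((r ^ m1 * ycoeff (- (- l)) F) * (r ^ m2 * ycoeff (- (k + l)) (F ^ a)))"
      using False by (intro pos_below_mult base Suc.IH) auto
    then show ?thesis
      using \<open>m = m1 + m2\<close> by (simp add: power_add ac_simps)
  qed
  show ?case
    unfolding pos_below_def
  proof (intro allI impI)
    fix n assume "n < N"
    then show "upos (fps_nth (r ^ m * ycoeff (- k) (F ^ Suc a)) n)"
      using summand_pos by (simp only: power_Suc L(2)[OF less_imp_le]) (auto simp: pos_below_def intro!: upos_sum)
  qed
qed


section \<open>The equation for R in terms of trees\<close>

text \<open>With a = (q - 1) i, the number of trees is ((2 q - 1) i)! / (i! (2 a + 1)!), and (2 a +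
  1)! cancels against the numerator of the binomial coefficient.\<close>

lemma cR_eq_fuss:
  assumes "0 < q"
  shows "cR q i = real (fuss (2 * q - 1) i 1 * (((2 * q - 2) * i + 1) choose ((q - 1) * i + 1)))"
proof -
  define a where "a = (q - 1) * i"
  have a: "1 + (2 * q - 1) * i - i = 2 * a + 1" "(2 * q - 2) * i + 1 = 2 * a + 1"
    using assms by (cases q; simp add: a_def algebra_simps)+
  have "real (fuss (2 * q - 1) i 1) * (fact i * fact (2 * a + 1)) = fact ((2 * q - 1) * i)"
    using fuss_closed_form[of "2 * q - 1" 1 i] assms unfolding a by simp
  then have "real (fuss (2 * q - 1) i 1) = fact ((2 * q - 1) * i) / (fact i * fact (2 * a + 1))"
    by (simp add: divide_simps)
  moreover have "real ((2 * a + 1) choose (a + 1)) = fact (2 * a + 1) / (fact (a + 1) * fact a)"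
    by (subst binomial_fact) auto
  ultimately show ?thesis
    unfolding cR_def a(2) a_def[symmetric] of_nat_mult by (simp del: fact_Suc)
qed

context
  fixes q :: nat and r :: "real poly fps"
  assumes q: "2 \<le> q"
begin

text \<open>The weight of a node: i nodes supply the middle factor of (z r)^((q - 1) i + 1) = z
  z^((q - 1) i) r^((q - 1) i + 1).\<close>

definition zpow where "zpow = (fps_X ^ (q - 1) :: real poly fps)"

definition leaf where "leaf = scalar r * ypow 1 + ypow (-1)"

definition trees where "trees = fuss_series (2 * q - 1) (scalar zpow) leaf 1"

lemma zpow_nth_0: "fps_nth zpow 0 = 0"
  using q by (simp add: zpow_def)

lemma scalar_zpow_nth_0: "fps_nth (scalar zpow) 0 = 0"
  by (simp add: scalar_def zpow_nth_0)

lemma trees_eq: "trees = leaf + scalar zpow * trees ^ (2 * q - 1)"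
  unfolding trees_def using q
  by (subst (1) fuss_series_1[OF _ scalar_zpow_nth_0], simp)
     (subst fuss_series_power[OF _ scalar_zpow_nth_0], auto)

text \<open>Expansion by the number i of nodes, through which facts about powers of
  \<open>leaf\<close> carry over term by term.\<close>

lemma ycoeff_trees_power:
  "ycoeff k (trees ^ a) = fsum (\<lambda>i. of_nat (fuss (2 * q - 1) i a)
     * ycoeff k (leaf ^ ((2 * q - 2) * i + a)) * zpow ^ i)"
proof -
  have "trees ^ a = fuss_series (2 * q - 1) (scalar zpow) leaf a"
    unfolding trees_def using q
    by (subst (2) fuss_series_power[OF _ scalar_zpow_nth_0]) auto
  moreover have "of_nat m * F * scalar zpow ^ i = scalar (of_nat m * zpow ^ i) * F" for m F i
  proof -
    have "scalar (of_nat m :: real poly fps) = of_nat m"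
      by (rule fps_ext) (simp add: scalar_def flip: fps_of_nat)
    then show ?thesis
      by (simp add: scalar_mult scalar_power ac_simps)
  qed
  moreover have "2 * q - 1 - 1 = 2 * q - 2" by simp
  ultimately show ?thesis
    by (simp only: fuss_series_def ycoeff_fsum ycoeff_scalar_mult) (simp add: ac_simps)
qed

lemmas ycoeff_trees = ycoeff_trees_power[of _ 1, unfolded power_one_right]

text \<open>A tree with i nodes has (2 q - 2) i + 1 leaves, an odd number, and each leaf shifts the
  exponent of y by 1 or -1.\<close>

lemma ycoeff_trees_even:
  assumes "even k"
  shows "ycoeff k trees = 0"
proof -
  have "ycoeff k (leaf ^ ((2 * q - 2) * i + 1)) = 0" for i
    unfolding leaf_def by (rule ycoeff_binomial_eq_0) (use assms in \<open>simp add: even_diff_nat\<close>)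
  then show ?thesis
    by (simp only: ycoeff_trees) (simp add: fsum_def fps_eq_iff)
qed

lemma ycoeff_trees_power_symmetric:
  "ycoeff (int k) (trees ^ a) = r ^ k * ycoeff (- int k) (trees ^ a)"
  by (simp only: ycoeff_trees_power leaf_def ycoeff_binomial_symmetric[of k]
      fsum_mult_left[OF summandI[OF zpow_nth_0 refl]]) (simp add: ac_simps)

lemma ycoeff_trees_symmetric: "ycoeff (int k) trees = r ^ k * ycoeff (- int k) trees"
  using ycoeff_trees_power_symmetric[of k 1] by simp

text \<open>The i-th term of [y] B is c_i r^((q - 1) i + 1) z^((q - 1) i). The term i = 0 is r,
  which is subtracted because \<open>Rsum\<close> starts at i = 1.\<close>

lemma Rsum_eq: "Rsum q (fps_X * r) = fps_X * (ycoeff 1 trees - r)"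
proof (rule fps_ext)
  fix n
  define g where "g i = of_nat (fuss (2 * q - 1) i 1)
     * ycoeff 1 (leaf ^ ((2 * q - 2) * i + 1)) * zpow ^ i" for i
  have g: "g i = fps_const [:cR q i:] * (r ^ ((q - 1) * i + 1) * zpow ^ i)" for i
  proof -
    have "1 + int ((2 * q - 2) * i + 1) = 2 * int ((q - 1) * i + 1)"
      using q by (cases q) (auto simp: algebra_simps)
    from ycoeff_binomial_eq[OF this, of r]
    have "g i = of_nat (fuss (2 * q - 1) i 1 * (((2 * q - 2) * i + 1) choose ((q - 1) * i + 1)))
        * (r ^ ((q - 1) * i + 1) * zpow ^ i)"
      by (simp add: g_def leaf_def)
    moreover have "of_nat m = fps_const [:real m:]" for m
      by (simp add: of_nat_poly flip: fps_of_nat)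
    ultimately show ?thesis
      using q by (simp add: cR_eq_fuss)
  qed
  have "ycoeff 1 trees = g 0 + fsum (\<lambda>i. g (Suc i))"
    unfolding ycoeff_trees g_def by (rule fsum_Suc[OF summandI[OF zpow_nth_0 refl]])
  moreover have "g 0 = r"
    by (simp add: g cR_def flip: one_pCons)
  ultimately have eq: "ycoeff 1 trees - r = fsum (\<lambda>i. g (Suc i))"
    by simp
  have pow: "(fps_X * r) ^ ((q - 1) * i + 1) = fps_X * (r ^ ((q - 1) * i + 1) * zpow ^ i)" for i
    by (simp add: zpow_def power_mult_distrib ac_simps flip: power_mult)
  show "fps_nth (Rsum q (fps_X * r)) n = fps_nth (fps_X * (ycoeff 1 trees - r)) n"
  proof (cases n)
    case 0
    then show ?thesis by (simp add: Rsum_def)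
  next
    case (Suc n')
    \<comment> \<open>The range 1..n in \<open>Rsum\<close> matches the shifted range of
      \<open>fsum\<close> exactly, since the factor z lowers the degree to n' = n - 1.\<close>
    have "fps_nth (Rsum q (fps_X * r)) n
        = (\<Sum>i=Suc 0..Suc n'. fps_nth (g i) n')"
      unfolding Rsum_def pow Suc by (simp add: g del: sum.cl_ivl_Suc)
    also have "\<dots> = (\<Sum>i\<le>n'. fps_nth (g (Suc i)) n')"
      by (simp only: sum.shift_bounds_cl_Suc_ivl atMost_atLeast0)
    finally show ?thesis
      by (simp add: eq Suc fsum_nth)
  qed
qed

lemma ycoeff_leaf:
  "ycoeff 1 leaf = r" "k < 0 \<Longrightarrow> ycoeff k leaf = (if k = -1 then 1 else 0)"
  by (auto simp: leaf_def ycoeff_add ycoeff_scalar_mult ycoeff_ypow)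

lemma ycoeff_1_trees_minus_r: "ycoeff 1 trees - r = zpow * ycoeff 1 (trees ^ (2 * q - 1))"
  by (subst trees_eq) (simp add: ycoeff_add ycoeff_scalar_mult ycoeff_leaf)


section \<open>Positivity of the tree coefficients\<close>

text \<open>By \<open>trees_eq\<close>, a coefficient of B is a leaf term plus z^(q - 1) times a
  coefficient of B^(2 q - 1). As q - 1 > 0, positivity of B below degree N gives that of the second
  term below N + 1.\<close>

lemma pos_below_ycoeff_trees:
  assumes r: "r = 1 + fps_const [:0, 1:] * (ycoeff 1 trees - r)"
    and "odd l" "int m \<le> max l 0"
  shows "pos_below N (r ^ m * ycoeff (- l) trees)"
  using assms(2,3)
proof (induction N arbitrary: l m)
  case 0
  show ?case by (simp add: pos_below_def)
next
  case (Suc N)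
  have pow: "pos_below (Suc N) (zpow * (r ^ m * ycoeff (- k) (trees ^ (2 * q - 1))))"
    if "odd k" "int m \<le> max k ((k + int (2 * q - 1)) div 2)" "0 < k" for k m
    unfolding zpow_def
  proof (rule pos_below_Suc_X_power_mult[OF pos_below_ycoeff_power])
    show "2 * int m \<le> max (max (2 * k) (k + int (2 * q - 1))) 0"
      using that by linarith
    show "even (k + int (2 * q - 1))"
      using that q by simp
  qed (use q Suc.IH ycoeff_trees_even in auto)
  have pos: "pos_below (Suc N) (r ^ m * ycoeff (- l) trees)" if "odd l" "int m \<le> l" "0 < l" for l m
  proof (cases "l = 1 \<and> m = 1")
    case True
    define \<Phi> where "\<Phi> = ycoeff 1 trees - r"
    have "\<Phi> = zpow * (r ^ 1 * ycoeff (- 1) (trees ^ (2 * q - 1)))"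
      unfolding \<Phi>_def ycoeff_1_trees_minus_r using ycoeff_trees_power_symmetric[of 1] by simp
    then have "pos_below (Suc N) \<Phi>"
      using pow[of 1 1] q by simp
    moreover have "r ^ m * ycoeff (- l) trees = 1 + fps_const [:1, 1:] * \<Phi>"
    proof -
      have "r ^ m * ycoeff (- l) trees = ycoeff 1 trees"
        using ycoeff_trees_symmetric[of 1] True by simp
      also have "\<dots> = 1 + fps_const [:0, 1:] * \<Phi> + \<Phi>"
        using r unfolding \<Phi>_def by (metis add.commute diff_add_cancel)
      also have "\<dots> = 1 + (fps_const [:0, 1:] + fps_const [:1:]) * \<Phi>"
        by (simp only: one_pCons[symmetric] fps_const_1_eq_1 distrib_right mult_1 add.assoc)
      finally show ?thesis by (simp only: fps_const_add) simp
    qed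
    ultimately show ?thesis
      by (simp only:) (intro pos_below_add pos_below_mult pos_below_1 pos_below_const upos_u_plus_1)
  next
    case False
    have "r ^ m * ycoeff (- l) trees
        = r ^ m * ycoeff (- l) leaf + zpow * (r ^ m * ycoeff (- l) (trees ^ (2 * q - 1)))"
      by (subst trees_eq) (simp add: ycoeff_add ycoeff_scalar_mult algebra_simps)
    moreover have "pos_below (Suc N) (r ^ m * ycoeff (- l) leaf)"
      using False that by (cases "m = 0"; cases "l = 1") (auto simp: ycoeff_leaf pos_below_0 pos_below_1)
    ultimately show ?thesis
      using pow[of l m] that by (auto intro: pos_below_add)
  qed
  show ?case
  proof (cases "0 < l")
    case True
    then show ?thesis using pos Suc.prems by simp
  next
    case False
    with Suc.prems have "l < 0" "m = 0"
      by (cases "l = 0"; auto)+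
    \<comment> \<open>The positive exponent -l is reflected to l, which brings in r^(-l), exactly
      the power allowed in \<open>pos\<close>.\<close>
    then have "r ^ m * ycoeff (- l) trees = r ^ nat (- l) * ycoeff (- (- l)) trees"
      using ycoeff_trees_symmetric[of "nat (- l)"] by simp
    then show ?thesis
      using pos[of "- l" "nat (- l)"] \<open>l < 0\<close> Suc.prems by simp
  qed
qed

end

section \<open>Differences of powers of R\<close>

theorem theorem5p3p1:
  fixes q :: nat and R :: "real poly fps"
  assumes "q \<ge> 2"
    and "fps_nth R 0 = 0"
    and "R = fps_X + fps_const [:0, 1:] * Rsum q R"
  shows "\<forall>n \<in> {1..q}. \<exists>A :: real poly fps.
           R ^ n - fps_X ^ n = fps_const [:0, 1:] * A \<and> u_plus_one_positive A"
proof
  fix n assume n: "n \<in> {1..q}"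
  define r where "r = fps_shift 1 R"
  define T where "T = trees q r"
  define \<beta> where "\<beta> = ycoeff (- 1) (T ^ (2 * q - 1))"
  \<comment> \<open>Here R - z = u \<open>Rsum q R\<close>, and the sum is the cofactor of R - z in
    R^n - z^n.\<close>
  define A where "A = Rsum q R * (\<Sum>i<n. fps_X ^ (n - Suc i) * R ^ i)"
  have R: "R = fps_X * r"
    by (rule fps_ext) (use assms(2) in \<open>auto simp: r_def\<close>)
  have Rsum: "Rsum q R = fps_X * (ycoeff 1 T - r)"
    unfolding R T_def by (rule Rsum_eq[OF assms(1)])
  have "fps_X * r = fps_X * (1 + fps_const [:0, 1:] * (ycoeff 1 T - r))"
    using assms(3) unfolding Rsum unfolding R by (simp add: algebra_simps)
  then have r: "r = 1 + fps_const [:0, 1:] * (ycoeff 1 T - r)"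
    by (metis fps_X_neq_zero mult_left_cancel)
  have base: "pos_below N (r ^ m * ycoeff (- l) T)" if "odd l" "int m \<le> max l 0" for l m N
    unfolding T_def by (rule pos_below_ycoeff_trees[OF assms(1) r[unfolded T_def] that])
  \<comment> \<open>The summand of \<open>A\<close> with index i contains \<Phi> R^i and hence r^(i
    + 1). A product of 2 q - 1 odd powers of y with total degree -1 absorbs up to q powers of r;
    this is where n \<le> q enters.\<close>
  have \<beta>: "pos_below N (r ^ Suc i * \<beta>)" if "i < n" for i N
    unfolding \<beta>_def
  proof (rule pos_below_ycoeff_power)
    show "even (1 + int (2 * q - 1))" "2 * int (Suc i) \<le> max (max (2 * 1) (1 + int (2 * q - 1))) 0"
      using n that by auto
  qed (use base ycoeff_trees_even[OF assms(1)] T_def in auto)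
  have "A = fps_X * zpow q * (\<Sum>i<n. fps_X ^ (n - Suc i) * fps_X ^ i * (r ^ Suc i * \<beta>))"
  proof -
    have "ycoeff 1 T - r = zpow q * (r * \<beta>)"
      unfolding T_def \<beta>_def ycoeff_1_trees_minus_r[OF assms(1)]
      using ycoeff_trees_power_symmetric[OF assms(1), of 1 r] by simp
    then show ?thesis
      unfolding A_def Rsum unfolding R by (simp add: sum_distrib_left power_mult_distrib ac_simps)
  qed
  moreover have "pos_below N (\<Sum>i<n. fps_X ^ (n - Suc i) * fps_X ^ i * (r ^ Suc i * \<beta>))" for N
    by (rule pos_below_sum, rule pos_below_mult[OF pos_below_mult[OF pos_below_X_power pos_below_X_power] \<beta>])
      simp
  moreover have "fps_X * zpow q = (fps_X ^ q :: real poly fps)"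
    using assms(1) by (simp add: zpow_def flip: power_Suc)
  ultimately have "pos_below N A" for N
    by (simp only: pos_below_mult[OF pos_below_X_power])
  then have "u_plus_one_positive A"
    unfolding u_plus_one_positive_def pos_below_def upos_def by blast
  moreover have "R ^ n - fps_X ^ n = fps_const [:0, 1:] * A"
  proof -
    have "R - fps_X = fps_const [:0, 1:] * Rsum q R"
      using assms(3) by (metis add_diff_cancel_left')
    then show ?thesis
      by (simp only: power_diff_sumr2[of R n fps_X] A_def mult.assoc)
  qed
  ultimately show "\<exists>A :: real poly fps.
      R ^ n - fps_X ^ n = fps_const [:0, 1:] * A \<and> u_plus_one_positive A"
    by blast
qed

end
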